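(* Let $\mathcal{I}=\{1,\dots,N\}$, let $n_i$ ($i\in\mathcal{I}$) be positive integers with $\sum_{i\in\mathcal{I}}n_i=n$, let $g:\mathbb{R}^n\to\mathbb{R}^m$ be an affine map and let $P\subset\mathbb{R}^m$ be non-empty, convex and compact. Suppose that for every $i\in\mathcal{I}$: (i) $M_i:P\rightrightarrows\mathbb{R}^{n_i}$ is a convex-valued, lower semi-continuous and closed multi-valued map such that $M_i(p)$ has non-empty interior for each $p\in P$; (ii) $G_i:\mathbb{R}^{n_i}\rightrightarrows\mathbb{R}^{n_i}$ is locally upper sign-continuous, dually lower semi-continuous and quasimonotone over the set $\mathrm{co}(M_i(P))$, where $M_i(P)=\bigcup_{p\in P}M_i(p)$; (iii) for each $p\in P$ there is $r^i_p>0$ such that for every $y_i\in M_i(p)\setminus\bar B(0,r^i_p)$ there exists $z_i\in M_i(p)$ with $\|z_i\|<\|y_i\|$ satisfying $\langle y_i^*,z_i-y_i\rangle\le 0$ for each $y_i^*\in G_i(y_i)$. Put $M(p)=\prod_{i\in\mathcal{I}}M_i(p)$ for $p\in P$. Assume that for every $i\in\mathcal{I}$ there exists some $r_i>\sup\{r^i_p : p\in P\}$ such that $M_i(p)\cap\bar B(0,r_i)\neq\emptyset$ for every $p\in P$. Then there exist $\bar p\in P$, $\bar y=(\bar y_1,\dots,\bar y_N)\in M(\bar p)$ and $\bar y^*=(\bar y_1^*,\dots,\bar y_N^* )$ with $\bar y_i^*\in G_i(\bar y_i)\setminus\{0\}$ for every $i\in\mathcal{I}$ such that $$\langle g(\bar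 y),p-\bar p\rangle+\langle\bar y^*,z-\bar y\rangle\ge 0\quad\text{for all }(p,z)\in P\times M(\bar p).$$
   Context: $\bar B(0,r)$ is the closed Euclidean ball of radius $r$ centred at $0$ (in the relevant space); $\mathrm{co}$ denotes convex hull. A multi-valued map is closed if its graph is closed. A map $T:\mathbb{R}^k\rightrightarrows\mathbb{R}^k$ is quasimonotone over $K\subseteq\mathbb{R}^k$ if for all $v,w\in K$: if there exists $v^*\in T(v)$ with $\langle v^*,w-v\rangle> 0$, then $\langle w^*,w-v\rangle\ge 0$ for all $w^*\in T(w)$. A map $T$ is dually lower semi-continuous over $K$ if for each $v\in K$ and any sequence $(u_n)$ in $K$ with $u_n\to u$ ($u\in K$): $\liminf_n\sup_{u_n^*\in T(u_n)}\langle u_n^*,v-u_n\rangle\le 0$ implies $\sup_{u^*\in T(u)}\langle u^*,v-u\rangle\le 0$. A map $T$ is upper sign-continuous over a convex set $K$ if for all $u,v\in K$, with $u_s=su+(1-s)v$: if $\inf_{u_s^*\in T(u_s)}\langle u_s^*,v-u\rangle\ge 0$ for all $s\in(0,1)$, then $\sup_{u^*\in T(u)}\langle u^*,v-u\rangle\ge 0$. A map $T:\mathbb{R}^k\rightrightarrows\mathbb{R}^k$ is locally upper sign-continuous at $u$ if there are a convex open set $\mathcal{O}_u$ containing $u$ and a map $\psi_u:\mathcal{O}_u\rightrightarrows\mathbb{R}^k$ that is upper sign-continuous over $\mathcal{O}_u$ and such that $\psi_u(\tilde u)$ is a non-empty convex compact subset of $T(\tilde u)\setminus\{0\}$ for every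 $\tilde u\in\mathcal{O}_u$. It is locally upper sign-continuous over a set if it is so at each point of the set. *)

theory Defs
  imports "HOL-Analysis.Analysis"
begin

text \<open>
  The spaces \<open>\<real>\<^sup>n\<^sup>i\<close> of varying dimension, with product \<open>\<real>\<^sup>n\<close>, are rendered inside
  \<open>real ^ 'n\<close>: a labelling \<open>blk\<close> assigns to each of the \<open>n\<close> coordinates the block
  \<open>i\<close> it belongs to, the \<open>i\<close>-th factor is the coordinate subspace \<open>block_space blk i\<close>
  (of dimension the number of coordinates labelled \<open>i\<close>), and the \<open>i\<close>-th component
  of a vector \<open>y\<close> is \<open>block blk i y\<close>.  Norm and inner product of the factors
  are the ambient ones; openness and interior are taken relative to the factor.
\<close>

definition block_space :: "('n::finite \<Rightarrow> nat) \<Rightarrow> nat \<Rightarrow> (real ^ 'n) set" where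
  "block_space blk i = {x. \<forall>j. blk j \<noteq> i \<longrightarrow> x $ j = 0}"

definition block :: "('n::finite \<Rightarrow> nat) \<Rightarrow> nat \<Rightarrow> real ^ 'n \<Rightarrow> real ^ 'n" where
  "block blk i y = (\<chi> j. if blk j = i then y $ j else 0)"

definition block_product ::
    "('n::finite \<Rightarrow> nat) \<Rightarrow> nat set \<Rightarrow> (nat \<Rightarrow> (real ^ 'n) set) \<Rightarrow> (real ^ 'n) set" where
  "block_product blk I A = {y. \<forall>i\<in>I. block blk i y \<in> A i}"

definition affine_map :: "('a::real_vector \<Rightarrow> 'b::real_vector) \<Rightarrow> bool" where
  "affine_map g \<longleftrightarrow> (\<exists>A b. linear A \<and> (\<forall>x. g x = A x + b))"

definition lower_semicontinuous_map ::
    "'a::topological_space set \<Rightarrow> ('a \<Rightarrow> 'b::topological_space set) \<Rightarrow> bool" where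
  "lower_semicontinuous_map P T \<longleftrightarrow>
     (\<forall>V. open V \<longrightarrow> openin (top_of_set P) {p \<in> P. T p \<inter> V \<noteq> {}})"

definition map_graph :: "'a set \<Rightarrow> ('a \<Rightarrow> 'b set) \<Rightarrow> ('a \<times> 'b) set" where
  "map_graph P T = {(p, y). p \<in> P \<and> y \<in> T p}"

definition quasimonotone_over ::
    "'a::real_inner set \<Rightarrow> ('a \<Rightarrow> 'a set) \<Rightarrow> bool" where
  "quasimonotone_over K T \<longleftrightarrow>
     (\<forall>v\<in>K. \<forall>w\<in>K. (\<exists>v'\<in>T v. v' \<bullet> (w - v) > 0) \<longrightarrow> (\<forall>w'\<in>T w. w' \<bullet> (w - v) \<ge> 0))"

text \<open>
  Suprema and infima below are taken in the extended reals, so that they are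
  \<open>-\<infinity>\<close> and \<open>\<infinity>\<close>, respectively, when the value of the map is empty.
\<close>

definition dually_lower_semicontinuous_over ::
    "'a::real_inner set \<Rightarrow> ('a \<Rightarrow> 'a set) \<Rightarrow> bool" where
  "dually_lower_semicontinuous_over K T \<longleftrightarrow>
     (\<forall>v\<in>K. \<forall>u\<in>K. \<forall>x :: nat \<Rightarrow> 'a. (\<forall>k. x k \<in> K) \<longrightarrow> x \<longlonglongrightarrow> u \<longrightarrow>
        liminf (\<lambda>k. SUP x'\<in>T (x k). ereal (x' \<bullet> (v - x k))) \<le> 0 \<longrightarrow>
        (SUP u'\<in>T u. ereal (u' \<bullet> (v - u))) \<le> 0)"

definition upper_sign_continuous_over ::
    "'a::real_inner set \<Rightarrow> ('a \<Rightarrow> 'a set) \<Rightarrow> bool" where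
  "upper_sign_continuous_over K T \<longleftrightarrow>
     (\<forall>u\<in>K. \<forall>v\<in>K.
        (\<forall>s\<in>{0<..<1::real}.
           (INF x\<in>T (s *\<^sub>R u + (1 - s) *\<^sub>R v). ereal (x \<bullet> (v - u))) \<ge> 0) \<longrightarrow>
        (SUP u'\<in>T u. ereal (u' \<bullet> (v - u))) \<ge> 0)"

text \<open>\<open>S\<close> is the space on which the map lives; the neighbourhood of \<open>u\<close> is open in \<open>S\<close>.\<close>

definition locally_upper_sign_continuous_at ::
    "'a::real_inner set \<Rightarrow> ('a \<Rightarrow> 'a set) \<Rightarrow> 'a \<Rightarrow> bool" where
  "locally_upper_sign_continuous_at S T u \<longleftrightarrow>
     (\<exists>U \<psi>. convex U \<and> openin (top_of_set S) U \<and> u \<in> U \<and>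
        upper_sign_continuous_over U \<psi> \<and>
        (\<forall>x\<in>U. \<psi> x \<noteq> {} \<and> convex (\<psi> x) \<and> compact (\<psi> x) \<and> \<psi> x \<subseteq> T x - {0}))"

definition locally_upper_sign_continuous_over ::
    "'a::real_inner set \<Rightarrow> 'a set \<Rightarrow> ('a \<Rightarrow> 'a set) \<Rightarrow> bool" where
  "locally_upper_sign_continuous_over S K T \<longleftrightarrow>
     (\<forall>u\<in>K. locally_upper_sign_continuous_at S T u)"

end

theory Submission imports Defs begin

text \<open>
  After truncating each constraint set to \<open>K\<^sub>i(p) = M\<^sub>i(p) \<inter> cball 0 R\<^sub>i\<close>, the Stampacchia
  solutions with nonzero multiplier over \<open>K\<^sub>i(p)\<close> coincide with the Minty solutions, because
  \<open>K\<^sub>i(p)\<close> has interior points.  They therefore form a non-empty compact convex set, which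
  depends on \<open>p\<close> with closed graph.  Kakutani's theorem applied to the product of these solution maps
  and of \<open>y \<mapsto> argmin\<^bsub>q\<in>P\<^esub> \<langle>g(y), q\<rangle>\<close> yields a solution of the truncated problem, and the
  coercivity condition (iii) shows that the truncation is harmless.
\<close>

section \<open>Kakutani's theorem and a minimax lemma\<close>

text \<open>Without a fixed point, every \<open>x\<close> is strictly separated from the closed
  convex set \<open>F x\<close> by some functional. Separation by a given functional is an open
  condition in \<open>x\<close>, so finitely many functionals suffice on \<open>C\<close>; gluing
  them with continuous weights reduces the claim to Brouwer's theorem.\<close>

theorem kakutani:
  fixes F :: "'a::euclidean_space \<Rightarrow> 'a set"
  assumes C: "compact C" "convex C" "C \<noteq> {}"
    and F: "\<And>x. x \<in> C \<Longrightarrow> F x \<noteq> {}" "\<And>x. x \<in> C \<Longrightarrow> convex (F x)" "\<And>x. x \<in> C \<Longrightarrow> F x \<subseteq> C"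
    and graph: "closed (map_graph C F)"
  shows "\<exists>x\<in>C. x \<in> F x"
proof (rule ccontr)
  assume no_fix: "\<not> ?thesis"
  have closed_F: "closed (F x)" if "x \<in> C" for x
  proof -
    have "closed (Pair x -` map_graph C F)"
      by (intro continuous_closed_vimage graph continuous_intros)
    also have "Pair x -` map_graph C F = F x"
      using that by (auto simp: map_graph_def)
    finally show ?thesis .
  qed
  have cgraph: "compact (map_graph C F)"
  proof -
    have "map_graph C F = map_graph C F \<inter> C \<times> C" using F(3) by (auto simp: map_graph_def)
    then show ?thesis using closed_Int_compact[OF graph compact_Times[OF C(1) C(1)]] by simp
  qed
  \<comment> \<open>\<open>B a\<close> collects the points at which \<open>a\<close> fails to
    separate; it is closed as the projection of a compact part of the graph.\<close>
  define B where "B a = {x\<in>C. \<exists>y\<in>F x. a \<bullet> (y - x) \<le> 0}" for a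
  have "compact (B a)" for a
  proof -
    have "closed {z :: 'a \<times> 'a. a \<bullet> (snd z - fst z) \<le> 0}"
      by (intro closed_Collect_le continuous_intros)
    then have "compact (fst ` (map_graph C F \<inter> {z. a \<bullet> (snd z - fst z) \<le> 0}))"
      by (intro compact_continuous_image continuous_intros compact_Int_closed cgraph)
    also have "fst ` (map_graph C F \<inter> {z. a \<bullet> (snd z - fst z) \<le> 0}) = B a"
      by (force simp: B_def map_graph_def)
    finally show ?thesis .
  qed
  then have closed_B: "closed (B a)" for a
    by (rule compact_imp_closed)
  have "C \<subseteq> (\<Union>a\<in>UNIV. - B a)"
  proof
    fix x assume x: "x \<in> C"
    then have "x \<notin> F x" using no_fix by blast
    then obtain a b where ab: "a \<bullet> x < b" "\<forall>y\<in>F x. a \<bullet> y > b"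
      using separating_hyperplane_closed_point[OF F(2) closed_F] x by meson
    then have "x \<notin> B a"
      by (fastforce simp: B_def inner_diff_right)
    then show "x \<in> (\<Union>a\<in>UNIV. - B a)" by blast
  qed
  then obtain A where A: "finite A" "C \<subseteq> (\<Union>a\<in>A. - B a)"
    using compactE_image[OF C(1), of UNIV "\<lambda>a. - B a"] closed_B by (metis open_Compl)
  \<comment> \<open>\<open>setdist\<close> to the empty set is 0, hence the case distinction.\<close>
  define \<phi> where "\<phi> a x = (if B a = {} then 1 else setdist {x} (B a))" for a x
  have \<phi>_pos: "\<phi> a x > 0 \<longleftrightarrow> x \<notin> B a" for a x
    using closed_B[of a] setdist_pos_le[of "{x}" "B a"]
    by (auto simp: \<phi>_def setdist_eq_0_closed less_le)
  have \<phi>_nonneg: "\<phi> a x \<ge> 0" for a x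
    by (simp add: \<phi>_def)
  have cont_\<phi>: "continuous_on C (\<phi> a)" for a
    by (cases "B a = {}") (simp_all add: \<phi>_def[abs_def] continuous_on_setdist)
  \<comment> \<open>Without fixed points, the continuous field \<open>v\<close> points from \<open>x\<close> strictly towards \<open>F x\<close>, which is
    impossible at a fixed point of \<open>x \<mapsto> closest_point C (x + v x)\<close>.\<close>
  define v where "v x = (\<Sum>a\<in>A. \<phi> a x *\<^sub>R a)" for x
  have v_pos: "v x \<bullet> (y - x) > 0" if "x \<in> C" "y \<in> F x" for x y
  proof -
    obtain a where a: "a \<in> A" "x \<notin> B a" using A(2) \<open>x \<in> C\<close> by blast
    have pos: "b \<bullet> (y - x) > 0" if "x \<notin> B b" for b
      using that \<open>x \<in> C\<close> \<open>y \<in> F x\<close> by (force simp: B_def)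
    have "0 < (\<Sum>b\<in>A. \<phi> b x * (b \<bullet> (y - x)))"
    proof (rule sum_pos2[OF A(1) a(1)])
      show "0 < \<phi> a x * (a \<bullet> (y - x))" using a pos \<phi>_pos by simp
      show "0 \<le> \<phi> b x * (b \<bullet> (y - x))" for b
        using pos[of b] \<phi>_pos[of b x] \<phi>_nonneg[of b x]
        by (cases "x \<in> B b") (auto simp: less_le)
    qed
    then show ?thesis by (simp add: v_def inner_sum_left)
  qed
  have cont: "continuous_on C (\<lambda>x. closest_point C (x + v x))"
    unfolding v_def
    by (rule continuous_on_compose2[OF continuous_on_closest_point[of C UNIV]])
      (use C compact_imp_closed cont_\<phi> in \<open>auto intro!: continuous_intros\<close>)
  obtain x where x: "x \<in> C" "closest_point C (x + v x) = x"
    using brouwer[OF C cont] C by (metis (no_types, lifting) Pi_I closest_point_in_set compact_imp_closed)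
  obtain y where y: "y \<in> F x" using F(1) x(1) by blast
  \<comment> \<open>Since \<open>x\<close> is the projection of \<open>x + v x\<close> onto
    \<open>C\<close>, \<open>v x\<close> is an outer normal of \<open>C\<close> at
    \<open>x\<close>.\<close>
  have "v x \<bullet> (y - x) \<le> 0"
    using closest_point_dot[of C y "x + v x"] C compact_imp_closed F(3)[OF x(1)] x(2) y by auto
  then show False using v_pos[OF x(1) y] by simp
qed

text \<open>If no common \<open>w\<close> exists, \<Psi> misses the dual cone \<open>D\<close> of
  \<open>A\<close>. A separating vector \<open>a\<close> is non-negative on \<open>D\<close>, hence
  by the bipolar theorem a limit of non-negative multiples of points of \<open>A\<close>. But
  \<open>a\<close> is uniformly negative on \<Psi>, whereas every such multiple is non-negative
  against some element of \<Psi>.\<close>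

lemma common_nonneg_functional:
  fixes \<Psi> A :: "'a::euclidean_space set"
  assumes \<Psi>: "compact \<Psi>" "convex \<Psi>" and A: "convex A" "A \<noteq> {}"
    and nonneg: "\<And>z. z \<in> A \<Longrightarrow> \<exists>w\<in>\<Psi>. w \<bullet> z \<ge> 0"
  shows "\<exists>w\<in>\<Psi>. \<forall>z\<in>A. w \<bullet> z \<ge> 0"
proof (rule ccontr)
  assume contra: "\<not> ?thesis"
  define D where "D = {w. \<forall>z\<in>A. w \<bullet> z \<ge> 0}"
  have D: "D = (\<Inter>z\<in>A. {w. z \<bullet> w \<ge> 0})"
    by (auto simp: D_def inner_commute)
  have "closed D" "convex D"
    unfolding D by (auto intro!: closed_INT closed_halfspace_ge convex_INT convex_halfspace_ge)
  moreover have "\<Psi> \<noteq> {}" "\<Psi> \<inter> D = {}"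
    using A nonneg contra by (auto simp: D_def)
  ultimately obtain a b where ab: "\<forall>w\<in>\<Psi>. a \<bullet> w < b" "\<forall>w\<in>D. a \<bullet> w > b"
    using separating_hyperplane_compact_closed[of \<Psi> D] \<Psi> by metis
  have b: "b < 0"
    using ab(2)[rule_format, of 0] by (simp add: D_def)
  have a_D: "a \<bullet> w \<ge> 0" if "w \<in> D" for w
  proof (rule ccontr)
    assume neg: "\<not> a \<bullet> w \<ge> 0"
    \<comment> \<open>Scaled by \<open>t\<close>, the vector \<open>w\<close> stays in the cone
      \<open>D\<close> but takes exactly the value \<open>b\<close>, against the strict
      separation.\<close>
    define t where "t = b / (a \<bullet> w)"
    have "t > 0" using neg b by (simp add: t_def divide_neg_neg)
    then have "t *\<^sub>R w \<in> D" using that by (simp add: D_def)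
    moreover have "a \<bullet> (t *\<^sub>R w) = b" using neg by (simp add: t_def)
    ultimately show False using ab(2) by fastforce
  qed
  have a_cl: "a \<in> closure (cone hull A)"
  proof (rule ccontr)
    assume "a \<notin> closure (cone hull A)"
    then obtain w c where wc: "w \<bullet> a < c" "\<forall>x\<in>closure (cone hull A). w \<bullet> x > c"
      using separating_hyperplane_closed_point[OF convex_closure[OF convex_cone_hull[OF A(1)]] closed_closure]
      by blast
    have wc': "w \<bullet> (t *\<^sub>R z) > c" if "z \<in> A" "t \<ge> 0" for z t
    proof -
      have "t *\<^sub>R z \<in> cone hull A" using that by (auto simp: cone_hull_expl)
      then show ?thesis using wc(2) closure_subset by blast
    qed
    have c: "c < 0"
      using A wc'[of _ 0] by auto
    have "w \<bullet> z \<ge> 0" if "z \<in> A" for z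
    proof (rule ccontr)
      assume neg: "\<not> w \<bullet> z \<ge> 0"
      then have "c / (w \<bullet> z) \<ge> 0" using c by (simp add: divide_nonpos_neg)
      from wc'[OF that this] neg show False by simp
    qed
    then have "a \<bullet> w \<ge> 0" by (intro a_D) (simp add: D_def)
    then show False using wc(1) c by (simp add: inner_commute)
  qed
  obtain K where K: "K > 0" "\<And>w. w \<in> \<Psi> \<Longrightarrow> norm w \<le> K"
    using compact_imp_bounded[OF \<Psi>(1)] by (meson bounded_pos)
  \<comment> \<open>The tolerance \<open>- b / K\<close> keeps \<open>w \<bullet> (x - a)\<close>
    below \<open>- b\<close> for all \<open>w\<close> in \<Psi> at once.\<close>
  obtain x where x: "x \<in> cone hull A" "dist x a < - b / K"
    using a_cl K(1) b closure_approachable by (metis divide_pos_pos neg_0_less_iff_less)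
  then obtain t z where tz: "x = t *\<^sub>R z" "t \<ge> 0" "z \<in> A"
    by (auto simp: cone_hull_expl)
  obtain w where w: "w \<in> \<Psi>" "w \<bullet> z \<ge> 0" using nonneg tz by blast
  have "w \<bullet> (x - a) \<le> norm w * norm (x - a)"
    by (rule norm_cauchy_schwarz)
  also have "\<dots> \<le> K * norm (x - a)"
    by (intro mult_right_mono K w) simp
  also have "\<dots> < - b"
    using x(2) K(1) by (simp add: dist_norm field_simps)
  finally have "w \<bullet> x < w \<bullet> a - b"
    by (simp add: inner_diff_right)
  moreover have "w \<bullet> a < b" using ab(1) w(1) by (metis inner_commute)
  moreover have "w \<bullet> x \<ge> 0" using w(2) tz by simp
  ultimately show False by simp
qed

section \<open>Minty and Stampacchia solutions\<close>

definition minty :: "'a::real_inner set \<Rightarrow> ('a \<Rightarrow> 'a set) \<Rightarrow> 'a set" where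
  "minty K T = {y\<in>K. \<forall>z\<in>K. \<forall>z'\<in>T z. z' \<bullet> (z - y) \<ge> 0}"

text \<open>A zero multiplier would satisfy the inequality trivially at every point and could not be
  strictly positive at relative interior points of \<open>K\<close>.\<close>

definition stampacchia :: "'a::real_inner set \<Rightarrow> ('a \<Rightarrow> 'a set) \<Rightarrow> 'a set" where
  "stampacchia K T = {y\<in>K. \<exists>y'\<in>T y - {0}. \<forall>z\<in>K. y' \<bullet> (z - y) \<ge> 0}"

text \<open>Each Minty inequality is affine in \<open>y\<close>; this supplies the convex values for
  Kakutani's theorem.\<close>

lemma convex_minty:
  assumes "convex K"
  shows "convex (minty K T)"
proof -
  have "minty K T = K \<inter> (\<Inter>z\<in>K. \<Inter>z'\<in>T z. {y. z' \<bullet> y \<le> z' \<bullet> z})"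
    by (auto simp: minty_def inner_diff_right)
  then show ?thesis
    using assms by (auto intro!: convex_Int convex_INT convex_halfspace_le)
qed

lemma ex_small_step:
  fixes v :: "'a::real_normed_vector"
  assumes "e > 0"
  obtains t where "0 < t" "t \<le> 1" "t * norm v < e"
proof
  \<comment> \<open>The \<open>+ 1\<close> covers \<open>v = 0\<close> and makes the bound
    strict.\<close>
  define t where "t = min 1 (e / (norm v + 1))"
  show "0 < t" "t \<le> 1" using assms by (auto simp: t_def add_nonneg_pos)
  have "t * norm v < t * (norm v + 1)" using \<open>0 < t\<close> by simp
  also have "\<dots> \<le> e / (norm v + 1) * (norm v + 1)"
    by (intro mult_right_mono) (auto simp: t_def)
  also have "\<dots> = e" by (simp add: add_nonneg_eq_0_iff)
  finally show "t * norm v < e" .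
qed

lemma convex_segment_step:
  assumes "convex K" "y \<in> K" "z \<in> K" "0 < t" "t \<le> 1"
  shows "y + t *\<^sub>R (z - y) \<in> K"
proof -
  have "(1 - t) *\<^sub>R y + t *\<^sub>R z \<in> K"
    using assms by (intro convexD) auto
  then show ?thesis by (simp add: algebra_simps)
qed

text \<open>The inequality is homogeneous along rays from \<open>y\<close>, and by convexity a ray
  towards \<open>z\<close> starts with points of \<open>K\<close> near \<open>y\<close>.\<close>

lemma nonneg_on_convex_if_nonneg_near:
  fixes y :: "'a::real_inner"
  assumes "convex K" "y \<in> K" "e > 0" and z: "z \<in> K"
    and near: "\<And>x. x \<in> K \<Longrightarrow> dist x y < e \<Longrightarrow> w \<bullet> (x - y) \<ge> 0"
  shows "w \<bullet> (z - y) \<ge> 0"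
proof -
  obtain t where t: "0 < t" "t \<le> 1" "t * norm (z - y) < e"
    using ex_small_step[OF \<open>e > 0\<close>] .
  then have "w \<bullet> (t *\<^sub>R (z - y)) \<ge> 0"
    using near[OF convex_segment_step[OF assms(1,2) z t(1,2)]] by (simp add: dist_norm)
  then show ?thesis using t by (simp add: zero_le_mult_iff)
qed

text \<open>Upper sign-continuity turns the Minty inequalities on the segment from \<open>y\<close>
  to \<open>z\<close> into a non-negative supremum at \<open>y\<close>, attained on the compact set
  \<open>\<psi> y\<close>. The minimax lemma then finds one element of \<open>\<psi> y\<close>,
  hence a non-zero element of \<open>T y\<close>, that serves all nearby \<open>z\<close>;
  homogeneity extends this to \<open>K\<close>.\<close>

lemma local_minty_imp_stampacchia:
  fixes T :: "'a::euclidean_space \<Rightarrow> 'a set"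
  assumes K: "convex K" "K \<subseteq> S" "y \<in> K"
    and lusc: "locally_upper_sign_continuous_at S T y"
    and e: "e > 0"
    and local_minty: "\<And>z z'. z \<in> K \<Longrightarrow> dist z y < e \<Longrightarrow> z' \<in> T z \<Longrightarrow> z' \<bullet> (z - y) \<ge> 0"
  shows "y \<in> stampacchia K T"
proof -
  obtain U \<psi> where U: "convex U" "openin (top_of_set S) U" "y \<in> U"
    and usc: "upper_sign_continuous_over U \<psi>"
    and \<psi>: "\<And>x. x \<in> U \<Longrightarrow> \<psi> x \<noteq> {}" "\<And>x. x \<in> U \<Longrightarrow> convex (\<psi> x)"
      "\<And>x. x \<in> U \<Longrightarrow> compact (\<psi> x)" "\<And>x. x \<in> U \<Longrightarrow> \<psi> x \<subseteq> T x - {0}"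
    using lusc unfolding locally_upper_sign_continuous_at_def by metis
  \<comment> \<open>On \<open>V\<close> the local selection \<psi> and the local Minty inequalities
    are available together.\<close>
  define V where "V = K \<inter> U \<inter> ball y e"
  have V: "convex V" "y \<in> V"
    using K U e by (auto simp: V_def convex_Int)
  have "\<exists>w\<in>\<psi> y. w \<bullet> (z - y) \<ge> 0" if z: "z \<in> V" for z
  proof -
    have "(INF x\<in>\<psi> (s *\<^sub>R y + (1 - s) *\<^sub>R z). ereal (x \<bullet> (z - y))) \<ge> 0" if s: "s \<in> {0<..<1}" for s
    proof (rule INF_greatest)
      fix x assume x: "x \<in> \<psi> (s *\<^sub>R y + (1 - s) *\<^sub>R z)"
      have "s *\<^sub>R y + (1 - s) *\<^sub>R z \<in> V"
        using V z s by (intro convexD) auto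
      then have "x \<bullet> ((s *\<^sub>R y + (1 - s) *\<^sub>R z) - y) \<ge> 0"
        using x \<psi>(4)[of "s *\<^sub>R y + (1 - s) *\<^sub>R z"]
        by (intro local_minty) (auto simp: V_def dist_commute)
      also have "(s *\<^sub>R y + (1 - s) *\<^sub>R z) - y = (1 - s) *\<^sub>R (z - y)"
        by (simp add: algebra_simps)
      finally show "0 \<le> ereal (x \<bullet> (z - y))"
        using s by (auto simp: zero_le_mult_iff)
    qed
    then have sup: "(SUP w\<in>\<psi> y. ereal (w \<bullet> (z - y))) \<ge> 0"
      using usc U(3) z unfolding upper_sign_continuous_over_def V_def by blast
    have "continuous_on (\<psi> y) (\<lambda>w. w \<bullet> (z - y))"
      by (intro continuous_intros)
    then obtain w where w: "w \<in> \<psi> y" "\<And>w'. w' \<in> \<psi> y \<Longrightarrow> w' \<bullet> (z - y) \<le> w \<bullet> (z - y)"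
      using continuous_attains_sup \<psi>(1,3) U(3) by metis
    have "(SUP w\<in>\<psi> y. ereal (w \<bullet> (z - y))) \<le> ereal (w \<bullet> (z - y))"
      by (intro SUP_least) (simp add: w)
    with sup have "0 \<le> ereal (w \<bullet> (z - y))" by (rule order_trans)
    then show ?thesis using w(1) by auto
  qed
  then have "\<exists>w\<in>\<psi> y. \<forall>x\<in>(\<lambda>z. z - y) ` V. w \<bullet> x \<ge> 0"
    using V U(3) \<psi> by (intro common_nonneg_functional) (auto intro: convex_translation_subtract)
  then obtain w where w: "w \<in> \<psi> y" "\<And>z. z \<in> V \<Longrightarrow> w \<bullet> (z - y) \<ge> 0"
    by blast
  obtain \<delta> where \<delta>: "\<delta> > 0" "ball y \<delta> \<inter> S \<subseteq> U"
    using U(2,3) unfolding openin_contains_ball by meson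
  have "w \<bullet> (z - y) \<ge> 0" if "z \<in> K" for z
  proof (rule nonneg_on_convex_if_nonneg_near[OF K(1,3), of "min \<delta> e"])
    show "w \<bullet> (x - y) \<ge> 0" if "x \<in> K" "dist x y < min \<delta> e" for x
    proof (rule w(2))
      have "x \<in> ball y \<delta> \<inter> S" using that K(2) by (auto simp: dist_commute)
      then show "x \<in> V" using that \<delta>(2) by (auto simp: V_def dist_commute)
    qed
  qed (use that \<delta>(1) e in auto)
  moreover have "w \<in> T y - {0}" using w(1) \<psi>(4) U(3) by blast
  ultimately show ?thesis using K(3) unfolding stampacchia_def by blast
qed

text \<open>A Minty solution is a Stampacchia solution. If there is none, compactness leaves
  finitely many Minty inequalities without common solution in \<open>K\<close>; a Brouwer fixed
  point built from them solves the Minty inequality locally by quasimonotonicity, which is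
  enough.\<close>

lemma stampacchia_nonempty:
  fixes T :: "'a::euclidean_space \<Rightarrow> 'a set"
  assumes K: "compact K" "convex K" "K \<noteq> {}" "K \<subseteq> S"
    and qm: "quasimonotone_over K T"
    and lusc: "\<And>y. y \<in> K \<Longrightarrow> locally_upper_sign_continuous_at S T y"
  shows "stampacchia K T \<noteq> {}"
proof (cases "minty K T = {}")
  case False
  then obtain y where "y \<in> K" "\<And>z z'. z \<in> K \<Longrightarrow> z' \<in> T z \<Longrightarrow> z' \<bullet> (z - y) \<ge> 0"
    by (auto simp: minty_def)
  \<comment> \<open>The Minty inequality holds on all of \<open>K\<close>, so any radius
    serves.\<close>
  then have "y \<in> stampacchia K T"
    by (intro local_minty_imp_stampacchia[where e = 1 and S = S] K lusc) auto
  then show ?thesis by blast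
next
  case True
  define I where "I = Sigma K T"
  have "\<exists>Q\<subseteq>I. finite Q \<and> K \<inter> (\<Inter>q\<in>Q. {y. snd q \<bullet> y \<le> snd q \<bullet> fst q}) = {}"
  proof (rule ccontr)
    assume "\<not> ?thesis"
    then have fip: "K \<inter> (\<Inter>q\<in>Q. {y. snd q \<bullet> y \<le> snd q \<bullet> fst q}) \<noteq> {}"
      if "finite Q" "Q \<subseteq> I" for Q
      using that by simp
    have "K \<inter> (\<Inter>q\<in>I. {y. snd q \<bullet> y \<le> snd q \<bullet> fst q}) \<noteq> {}"
      by (rule compact_imp_fip_image[OF K(1) closed_halfspace_le fip])
    then obtain y where y: "y \<in> K" "\<And>q. q \<in> I \<Longrightarrow> snd q \<bullet> y \<le> snd q \<bullet> fst q"
      by auto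
    have "z' \<bullet> y \<le> z' \<bullet> z" if "z \<in> K" "z' \<in> T z" for z z'
      using y(2)[of "(z, z')"] that by (simp add: I_def)
    with y(1) have "y \<in> minty K T" by (simp add: minty_def inner_diff_right)
    with True show False by simp
  qed
  then obtain Q where Q: "Q \<subseteq> I" "finite Q"
    and empty: "K \<inter> (\<Inter>q\<in>Q. {y. snd q \<bullet> y \<le> snd q \<bullet> fst q}) = {}"
    by blast
  have Q_K: "fst q \<in> K" "snd q \<in> T (fst q)" if "q \<in> Q" for q
    using Q(1) that by (auto simp: I_def)
  \<comment> \<open>A fixed point \<open>x\<close> of the \<open>\<phi>\<close>-weighted average of the points \<open>fst q\<close> violates proper
    quasimonotonicity, and the strict inequalities witnessing this persist near \<open>x\<close>.\<close>
  define \<phi> where "\<phi> q x = max 0 (snd q \<bullet> (x - fst q))" for q and x :: 'a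
  define \<Phi> where "\<Phi> x = (\<Sum>q\<in>Q. \<phi> q x)" for x
  have \<phi>_nonneg: "\<phi> q x \<ge> 0" for q x by (simp add: \<phi>_def)
  \<comment> \<open>At each point of \<open>K\<close> one of the inequalities in \<open>Q\<close>
    fails, and its weight is positive.\<close>
  have \<Phi>_pos: "\<Phi> x > 0" if x: "x \<in> K" for x
  proof -
    obtain q where "q \<in> Q" "snd q \<bullet> x > snd q \<bullet> fst q"
      using empty x by (force simp: not_le)
    then show ?thesis
      unfolding \<Phi>_def by (intro sum_pos2[OF Q(2)]) (auto simp: \<phi>_def inner_diff_right)
  qed
  define f where "f x = (\<Sum>q\<in>Q. (\<phi> q x / \<Phi> x) *\<^sub>R fst q)" for x
  have "continuous_on K f"
    unfolding f_def \<Phi>_def \<phi>_def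
    using \<Phi>_pos by (intro continuous_intros) (auto simp: \<Phi>_def \<phi>_def less_le)
  moreover have "f \<in> K \<rightarrow> K"
  proof
    fix x assume x: "x \<in> K"
    show "f x \<in> K"
      unfolding f_def
    proof (rule convex_sum[OF Q(2) K(2)])
      show "(\<Sum>q\<in>Q. \<phi> q x / \<Phi> x) = 1"
        using \<Phi>_pos[OF x] by (simp add: \<Phi>_def flip: sum_divide_distrib)
    qed (use \<Phi>_pos[OF x] \<phi>_nonneg Q_K in \<open>auto intro: divide_nonneg_pos\<close>)
  qed
  ultimately obtain x where x: "x \<in> K" "f x = x"
    using brouwer K by blast
  have "\<forall>q\<in>{q\<in>Q. \<phi> q x > 0}. \<exists>e>0. \<forall>w. dist w x < e \<longrightarrow> snd q \<bullet> (w - fst q) > 0"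
  proof
    fix q assume "q \<in> {q\<in>Q. \<phi> q x > 0}"
    then have "x \<in> {w. snd q \<bullet> w > snd q \<bullet> fst q}"
      by (auto simp: \<phi>_def inner_diff_right split: if_splits simp: max_def)
    moreover have "open {w. snd q \<bullet> w > snd q \<bullet> fst q}"
      by (rule open_halfspace_gt)
    ultimately show "\<exists>e>0. \<forall>w. dist w x < e \<longrightarrow> snd q \<bullet> (w - fst q) > 0"
      unfolding open_dist by (auto simp: inner_diff_right)
  qed
  then obtain e where e: "\<And>q. q \<in> Q \<Longrightarrow> \<phi> q x > 0 \<Longrightarrow> e q > 0"
    "\<And>q w. q \<in> Q \<Longrightarrow> \<phi> q x > 0 \<Longrightarrow> dist w x < e q \<Longrightarrow> snd q \<bullet> (w - fst q) > 0"
    by (metis (no_types, lifting) mem_Collect_eq)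
  \<comment> \<open>The extra 1 keeps the set non-empty for \<open>Min\<close>.\<close>
  define \<epsilon> where "\<epsilon> = Min (insert 1 (e ` {q\<in>Q. \<phi> q x > 0}))"
  have \<epsilon>: "\<epsilon> > 0" "\<And>q. q \<in> Q \<Longrightarrow> \<phi> q x > 0 \<Longrightarrow> \<epsilon> \<le> e q"
    using Q(2) e(1) by (auto simp: \<epsilon>_def)
  have "w' \<bullet> (w - x) \<ge> 0" if w: "w \<in> K" "dist w x < \<epsilon>" "w' \<in> T w" for w w'
  proof -
    \<comment> \<open>As \<open>x\<close> is the weighted average of the points
      \<open>fst q\<close>, this sum equals \<open>w' \<bullet> (w - x)\<close>. Where the weight is
      positive, \<open>snd q\<close> is strictly positive on \<open>w - fst q\<close>, so
      quasimonotonicity applies.\<close>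
    have "0 \<le> (\<Sum>q\<in>Q. (\<phi> q x / \<Phi> x) * (w' \<bullet> (w - fst q)))"
    proof (rule sum_nonneg)
      fix q assume q: "q \<in> Q"
      show "0 \<le> \<phi> q x / \<Phi> x * (w' \<bullet> (w - fst q))"
      proof (cases "\<phi> q x > 0")
        case True
        then have "snd q \<bullet> (w - fst q) > 0"
          using e(2) q w(2) \<epsilon>(2)[OF q] by (meson less_le_trans)
        then have "w' \<bullet> (w - fst q) \<ge> 0"
          using qm Q_K[OF q] w unfolding quasimonotone_over_def by blast
        then show ?thesis using True \<Phi>_pos[OF x(1)] by simp
      qed (use \<phi>_nonneg[of q x] in simp)
    qed
    also have "\<dots> = (\<Sum>q\<in>Q. \<phi> q x / \<Phi> x) * (w' \<bullet> w) - w' \<bullet> f x"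
      by (simp add: f_def inner_sum_right inner_diff_right right_diff_distrib sum_subtractf sum_distrib_right)
    also have "(\<Sum>q\<in>Q. \<phi> q x / \<Phi> x) = 1"
      using \<Phi>_pos[OF x(1)] by (simp add: \<Phi>_def flip: sum_divide_distrib)
    finally show ?thesis using x(2) by (simp add: inner_diff_right)
  qed
  then have "x \<in> stampacchia K T"
    by (intro local_minty_imp_stampacchia[where e = \<epsilon> and S = S] K x \<epsilon> lusc)
  then show ?thesis by blast
qed

text \<open>The homothety with centre \<open>z\<close> and ratio \<open>t\<close> produces this ball
  from the one about \<open>z0\<close>, and convexity keeps it in \<open>K\<close>; \<open>u\<close>
  is the preimage of \<open>x\<close>.\<close>

lemma relative_ball_shrink:
  fixes S :: "'a::real_normed_vector set"
  assumes S: "subspace S" and K: "convex K" "K \<subseteq> S" "z \<in> K"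
    and ball: "ball z0 e \<inter> S \<subseteq> K" and t: "0 < t" "t \<le> 1"
  shows "ball (z + t *\<^sub>R (z0 - z)) (t * e) \<inter> S \<subseteq> K"
proof
  fix x assume x: "x \<in> ball (z + t *\<^sub>R (z0 - z)) (t * e) \<inter> S"
  define u where "u = (1 / t) *\<^sub>R (x - (1 - t) *\<^sub>R z)"
  have x_eq: "x = (1 - t) *\<^sub>R z + t *\<^sub>R u" using t by (simp add: u_def)
  have "u \<in> S"
    unfolding u_def using x K by (intro subspace_scale[OF S] subspace_diff[OF S]) auto
  moreover have "z + t *\<^sub>R (z0 - z) - x = t *\<^sub>R (z0 - u)"
    by (simp add: x_eq algebra_simps)
  then have "dist z0 u < e" using x t by (simp add: dist_norm)
  ultimately have "u \<in> K" using ball by auto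
  then show "x \<in> K" unfolding x_eq using K t by (intro convexD) auto
qed

text \<open>A short step from \<open>z\<close> against \<open>w\<close> remains in \<open>K\<close>
  and strictly lowers the functional, which is still non-negative after the step.\<close>

lemma functional_pos_on_relative_interior:
  fixes S :: "'a::real_inner set"
  assumes S: "subspace S" "w \<in> S" "z \<in> S" and "w \<noteq> 0"
    and nonneg: "\<And>x. x \<in> K \<Longrightarrow> w \<bullet> (x - y) \<ge> 0"
    and "e > 0" and ball: "ball z e \<inter> S \<subseteq> K"
  shows "w \<bullet> (z - y) > 0"
proof -
  define t where "t = e / (2 * norm w)"
  have t: "t > 0" using assms by (simp add: t_def)
  have "z - t *\<^sub>R w \<in> S"
    using S by (intro subspace_scale subspace_diff) auto
  moreover have "dist z (z - t *\<^sub>R w) < e"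
    using assms by (simp add: t_def dist_norm)
  ultimately have "w \<bullet> (z - t *\<^sub>R w - y) \<ge> 0"
    using ball by (intro nonneg) auto
  moreover have "t * (w \<bullet> w) > 0" using t \<open>w \<noteq> 0\<close> by simp
  ultimately show ?thesis by (simp add: inner_diff_right)
qed

text \<open>Describes a single factor: \<open>S\<close> is the factor space and \<open>H\<close>
  will be the convex hull of all constraint values. Hypotheses over \<open>H\<close> allow points
  from the constraint sets of different parameters to be compared.\<close>

locale quasimonotone_operator =
  fixes S H :: "'a::euclidean_space set" and T :: "'a \<Rightarrow> 'a set"
  assumes S: "subspace S" and H: "H \<subseteq> S"
    and T_S: "\<And>x. x \<in> S \<Longrightarrow> T x \<subseteq> S"
    and lusc: "locally_upper_sign_continuous_over S H T"
    and dlsc: "dually_lower_semicontinuous_over H T"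
    and qm: "quasimonotone_over H T"
begin

text \<open>Every point of \<open>K\<close> is a limit of relative interior points on the segment
  towards \<open>z0\<close>, and dual lower semi-continuity carries the inequality to the
  limit.\<close>

lemma minty_if_on_relative_interior:
  assumes K: "convex K" "K \<subseteq> H" "y \<in> K"
    and z0: "z0 \<in> K" "e0 > 0" "ball z0 e0 \<inter> S \<subseteq> K"
    and int: "\<And>z e z'. z \<in> K \<Longrightarrow> e > 0 \<Longrightarrow> ball z e \<inter> S \<subseteq> K \<Longrightarrow> z' \<in> T z \<Longrightarrow> z' \<bullet> (z - y) \<ge> 0"
  shows "y \<in> minty K T"
proof -
  have "z' \<bullet> (z - y) \<ge> 0" if z: "z \<in> K" "z' \<in> T z" for z z'
  proof -
    \<comment> \<open>\<open>Suc k\<close> keeps the ratio in (0, 1], as shrinking the ball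
      requires.\<close>
    define x where "x k = z + (1 / real (Suc k)) *\<^sub>R (z0 - z)" for k
    have "x \<longlonglongrightarrow> z + 0 *\<^sub>R (z0 - z)"
      unfolding x_def by (intro tendsto_intros LIMSEQ_Suc[OF lim_1_over_n])
    then have x_lim: "x \<longlonglongrightarrow> z" by simp
    have ball: "ball (x k) (1 / real (Suc k) * e0) \<inter> S \<subseteq> K" for k
      unfolding x_def by (intro relative_ball_shrink[OF S]) (use K H z z0 in auto)
    have x_K: "x k \<in> K" for k
    proof -
      have "x k \<in> S"
        unfolding x_def using K H z z0 by (intro subspace_add subspace_scale subspace_diff S) auto
      then show ?thesis using ball[of k] z0(2) by auto
    qed
    have "(SUP x'\<in>T (x k). ereal (x' \<bullet> (y - x k))) \<le> 0" for k
    proof (rule SUP_least)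
      fix x' assume "x' \<in> T (x k)"
      then have "x' \<bullet> (x k - y) \<ge> 0" using int[OF x_K _ ball] z0(2) by simp
      then show "ereal (x' \<bullet> (y - x k)) \<le> 0" by (simp add: inner_diff_right)
    qed
    then have "liminf (\<lambda>k. SUP x'\<in>T (x k). ereal (x' \<bullet> (y - x k))) \<le> liminf (\<lambda>k. 0)"
      by (intro Liminf_mono) simp
    then have "liminf (\<lambda>k. SUP x'\<in>T (x k). ereal (x' \<bullet> (y - x k))) \<le> 0"
      by (simp add: Liminf_const)
    moreover have "y \<in> H" "z \<in> H" "\<forall>k. x k \<in> H" using K z x_K by auto
    ultimately have "(SUP u'\<in>T z. ereal (u' \<bullet> (y - z))) \<le> 0"
      using dlsc x_lim unfolding dually_lower_semicontinuous_over_def by blast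
    then have "ereal (z' \<bullet> (y - z)) \<le> 0"
      using z(2) by (meson SUP_upper order_trans)
    then show ?thesis by (simp add: inner_diff_right)
  qed
  then show ?thesis using K by (simp add: minty_def)
qed

text \<open>Minty solutions become Stampacchia solutions by local upper sign-continuity. Conversely,
  a non-zero multiplier is strictly positive at relative interior points, where quasimonotonicity
  yields the Minty inequalities; these extend to all of \<open>K\<close>.\<close>

lemma stampacchia_eq_minty:
  assumes K: "convex K" "K \<subseteq> H"
    and z0: "z0 \<in> K" "e0 > 0" "ball z0 e0 \<inter> S \<subseteq> K"
  shows "stampacchia K T = minty K T"
proof
  show "minty K T \<subseteq> stampacchia K T"
  proof
    fix y assume y: "y \<in> minty K T"
    then have "y \<in> K" by (simp add: minty_def)
    moreover have "locally_upper_sign_continuous_at S T y"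
      using lusc K(2) \<open>y \<in> K\<close> unfolding locally_upper_sign_continuous_over_def by blast
    ultimately show "y \<in> stampacchia K T"
      using y K H by (intro local_minty_imp_stampacchia[where e = 1 and S = S]) (auto simp: minty_def)
  qed
  show "stampacchia K T \<subseteq> minty K T"
  proof
    fix y assume "y \<in> stampacchia K T"
    then obtain y' where y: "y \<in> K" "y' \<in> T y" "y' \<noteq> 0" "\<And>z. z \<in> K \<Longrightarrow> y' \<bullet> (z - y) \<ge> 0"
      by (auto simp: stampacchia_def)
    show "y \<in> minty K T"
    proof (rule minty_if_on_relative_interior[OF K y(1) z0])
      fix z e z' assume z: "z \<in> K" "e > 0" "ball z e \<inter> S \<subseteq> K" "z' \<in> T z"
      have "y' \<in> S" "z \<in> S" using T_S[of y] y z(1) K H by auto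
      then have "y' \<bullet> (z - y) > 0"
        by (intro functional_pos_on_relative_interior[OF S _ _ y(3) y(4) z(2,3)])
      then show "z' \<bullet> (z - y) \<ge> 0"
        using qm y z K unfolding quasimonotone_over_def by blast
    qed
  qed
qed

lemma minty_nonempty:
  assumes K: "compact K" "convex K" "K \<subseteq> H"
    and z0: "z0 \<in> K" "e0 > 0" "ball z0 e0 \<inter> S \<subseteq> K"
  shows "minty K T \<noteq> {}"
proof -
  have "quasimonotone_over K T"
    using qm K(3) unfolding quasimonotone_over_def by blast
  moreover have "locally_upper_sign_continuous_at S T y" if "y \<in> K" for y
    using lusc K(3) that unfolding locally_upper_sign_continuous_over_def by blast
  ultimately have "stampacchia K T \<noteq> {}"
    using K H z0(1) by (intro stampacchia_nonempty[where S = S]) auto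
  then show ?thesis using stampacchia_eq_minty[OF K(2,3) z0] by simp
qed

text \<open>Since values of \<open>T\<close> may be unbounded, passing to the limit in the Minty inequality itself
  fails; instead normalized Stampacchia multipliers converge to a nonzero normal of the limit set,
  which is positive on the relative interior, so that quasimonotonicity applies.\<close>

lemma closed_graph_minty:
  fixes P :: "'p::metric_space set" and K :: "'p \<Rightarrow> 'a set"
  assumes conv: "\<And>p. p \<in> P \<Longrightarrow> convex (K p)" and K_H: "\<And>p. p \<in> P \<Longrightarrow> K p \<subseteq> H"
    and lsc: "lower_semicontinuous_map P K" and graph: "closed (map_graph P K)"
    and int: "\<And>p. p \<in> P \<Longrightarrow> \<exists>z\<in>K p. \<exists>e>0. ball z e \<inter> S \<subseteq> K p"
  shows "closed (map_graph P (\<lambda>p. minty (K p) T))"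
  unfolding closed_sequential_limits
proof (intro allI impI)
  fix c l assume cl: "(\<forall>n. c n \<in> map_graph P (\<lambda>p. minty (K p) T)) \<and> c \<longlonglongrightarrow> l"
  obtain p y where l: "l = (p, y)" by (cases l)
  define pn yn where "pn n = fst (c n)" and "yn n = snd (c n)" for n
  have pn: "pn n \<in> P" and yn: "yn n \<in> minty (K (pn n)) T" for n
    using cl by (auto simp: map_graph_def pn_def yn_def split_beta)
  have pn_lim: "pn \<longlonglongrightarrow> p" and yn_lim: "yn \<longlonglongrightarrow> y"
    unfolding pn_def yn_def using cl l tendsto_fst tendsto_snd by fastforce+
  have "c n \<in> map_graph P K" for n
    using cl by (auto simp: map_graph_def minty_def split_beta)
  then have "(p, y) \<in> map_graph P K"
    using graph cl l closed_sequentially by metis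
  then have p: "p \<in> P" and y: "y \<in> K p" by (auto simp: map_graph_def)
  have "\<exists>w. w \<in> T (yn n) \<and> w \<noteq> 0 \<and> (\<forall>z\<in>K (pn n). w \<bullet> (z - yn n) \<ge> 0)" for n
  proof -
    have "yn n \<in> stampacchia (K (pn n)) T"
      using stampacchia_eq_minty[OF conv K_H] int yn pn by blast
    then show ?thesis by (auto simp: stampacchia_def)
  qed
  then obtain w where w: "\<And>n. w n \<in> T (yn n)" "\<And>n. w n \<noteq> 0"
    "\<And>n z. z \<in> K (pn n) \<Longrightarrow> w n \<bullet> (z - yn n) \<ge> 0"
    by metis
  have yn_H: "yn n \<in> H" for n
    using yn[of n] K_H[OF pn[of n]] by (auto simp: minty_def)
  define v where "v n = w n /\<^sub>R norm (w n)" for n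
  have "v n \<in> sphere 0 1 \<inter> S" for n
  proof -
    have "w n \<in> S" using w(1) T_S yn_H H by blast
    then show ?thesis using w(2) by (simp add: v_def subspace_scale[OF S])
  qed
  moreover have "compact (sphere 0 1 \<inter> S)"
    using S closed_subspace by (intro compact_Int_closed) auto
  ultimately obtain v0 \<rho> where v0: "v0 \<in> sphere 0 1 \<inter> S" and \<rho>: "strict_mono \<rho>"
    and v_lim: "(v \<circ> \<rho>) \<longlonglongrightarrow> v0"
    unfolding compact_def by metis
  have pn_lim': "(pn \<circ> \<rho>) \<longlonglongrightarrow> p" and yn_lim': "(yn \<circ> \<rho>) \<longlonglongrightarrow> y"
    using pn_lim yn_lim \<rho> by (auto intro: LIMSEQ_subseq_LIMSEQ)
  have v_nonneg: "v n \<bullet> (z - yn n) \<ge> 0" if "z \<in> K (pn n)" for n z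
    using w(3)[OF that] by (simp add: v_def)
  have v_lim_z: "(\<lambda>n. v (\<rho> n) \<bullet> (z - yn (\<rho> n))) \<longlonglongrightarrow> v0 \<bullet> (z - y)" for z
    using v_lim yn_lim' by (intro tendsto_intros) (auto simp: o_def)
  have v0_nonneg: "v0 \<bullet> (z - y) \<ge> 0" if z: "z \<in> K p" for z
  proof (rule ccontr)
    assume neg: "\<not> ?thesis"
    \<comment> \<open>The gap is \<open>2 * \<epsilon>\<close>: one \<epsilon> for the limit, one
      for replacing \<open>z\<close> by the nearby \<open>z'\<close> in
      \<open>K (pn (\<rho> n))\<close> that lower semi-continuity supplies.\<close>
    define \<epsilon> where "\<epsilon> = - (v0 \<bullet> (z - y)) / 2"
    have \<epsilon>: "\<epsilon> > 0" using neg by (simp add: \<epsilon>_def)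
    have "openin (top_of_set P) {p \<in> P. K p \<inter> ball z \<epsilon> \<noteq> {}}"
      using lsc unfolding lower_semicontinuous_map_def by blast
    moreover have "p \<in> {p \<in> P. K p \<inter> ball z \<epsilon> \<noteq> {}}" using p z \<epsilon> by auto
    ultimately obtain \<delta> where \<delta>: "\<delta> > 0" "ball p \<delta> \<inter> P \<subseteq> {p \<in> P. K p \<inter> ball z \<epsilon> \<noteq> {}}"
      unfolding openin_contains_ball by meson
    have "\<forall>\<^sub>F n in sequentially. dist (pn (\<rho> n)) p < \<delta>"
      using tendstoD[OF pn_lim' \<delta>(1)] by (simp add: o_def)
    moreover have "\<forall>\<^sub>F n in sequentially. v (\<rho> n) \<bullet> (z - yn (\<rho> n)) < - \<epsilon>"
      using neg by (intro order_tendstoD(2)[OF v_lim_z]) (simp add: \<epsilon>_def)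
    ultimately have "\<forall>\<^sub>F n in sequentially. False"
    proof eventually_elim
      case (elim n)
      have "pn (\<rho> n) \<in> ball p \<delta> \<inter> P" using elim(1) pn by (simp add: dist_commute)
      then have "K (pn (\<rho> n)) \<inter> ball z \<epsilon> \<noteq> {}" using \<delta>(2) by blast
      then obtain z' where z': "z' \<in> K (pn (\<rho> n))" "dist z z' < \<epsilon>" by auto
      have "v (\<rho> n) \<bullet> (z' - z) \<le> norm (v (\<rho> n)) * norm (z' - z)"
        by (rule norm_cauchy_schwarz)
      also have "\<dots> < \<epsilon>" using z'(2) w(2) by (simp add: v_def dist_norm norm_minus_commute)
      finally show False
        using v_nonneg[OF z'(1)] elim(2) by (simp add: inner_diff_right)
    qed
    then show False by simp
  qed
  obtain z0 e0 where z0: "z0 \<in> K p" "e0 > 0" "ball z0 e0 \<inter> S \<subseteq> K p"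
    using int[OF p] by blast
  have "y \<in> minty (K p) T"
  proof (rule minty_if_on_relative_interior[OF conv[OF p] K_H[OF p] y z0])
    fix z e z' assume z: "z \<in> K p" "e > 0" "ball z e \<inter> S \<subseteq> K p" "z' \<in> T z"
    have z_H: "z \<in> H" "z \<in> S" using z(1) K_H[OF p] H by auto
    have "v0 \<bullet> (z - y) > 0"
      by (rule functional_pos_on_relative_interior[OF S _ _ _ v0_nonneg z(2,3)])
        (use v0 z_H in auto)
    then have "\<forall>\<^sub>F n in sequentially. v (\<rho> n) \<bullet> (z - yn (\<rho> n)) > 0"
      by (rule order_tendstoD(1)[OF v_lim_z])
    \<comment> \<open>Quasimonotonicity moves the inequality from the varying
      \<open>w (\<rho> n)\<close> to the fixed \<open>z'\<close>, so that only \<open>yn\<close> has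
      to pass to the limit.\<close>
    then have "\<forall>\<^sub>F n in sequentially. z' \<bullet> (z - yn (\<rho> n)) \<ge> 0"
    proof eventually_elim
      case (elim n)
      then have "w (\<rho> n) \<bullet> (z - yn (\<rho> n)) > 0"
        using w(2) by (simp add: v_def zero_less_mult_iff)
      then show ?case
        using qm w(1) yn_H z_H(1) z(4) unfolding quasimonotone_over_def by blast
    qed
    moreover have "(\<lambda>n. z' \<bullet> (z - yn (\<rho> n))) \<longlonglongrightarrow> z' \<bullet> (z - y)"
      using yn_lim' by (intro tendsto_intros) (auto simp: o_def)
    ultimately show "z' \<bullet> (z - y) \<ge> 0"
      by (intro tendsto_lowerbound) auto
  qed
  then show "l \<in> map_graph P (\<lambda>p. minty (K p) T)"
    using p l by (simp add: map_graph_def)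
qed

end

section \<open>Truncation\<close>

text \<open>Meeting an open set inside the closed ball amounts to meeting it inside the open ball,
  since convexity lets a boundary point move slightly towards a point of norm below
  \<open>R\<close>. For the open ball, lower semi-continuity of \<open>M\<close> applies.\<close>

lemma lower_semicontinuous_map_Int_cball:
  fixes M :: "'p::topological_space \<Rightarrow> 'a::real_normed_vector set"
  assumes lsc: "lower_semicontinuous_map P M"
    and conv: "\<And>p. p \<in> P \<Longrightarrow> convex (M p)"
    and slater: "\<And>p. p \<in> P \<Longrightarrow> \<exists>z\<in>M p. norm z < R"
  shows "lower_semicontinuous_map P (\<lambda>p. M p \<inter> cball 0 R)"
  unfolding lower_semicontinuous_map_def
proof (intro allI impI)
  fix V :: "'a set" assume V: "open V"
  have "M p \<inter> (ball 0 R \<inter> V) \<noteq> {}" if p: "p \<in> P" and ne: "M p \<inter> cball 0 R \<inter> V \<noteq> {}" for p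
  proof -
    obtain z where z: "z \<in> M p" "norm z \<le> R" "z \<in> V" using ne by auto
    obtain z0 where z0: "z0 \<in> M p" "norm z0 < R" using slater[OF p] by blast
    obtain e where e: "e > 0" "ball z e \<subseteq> V" using V z(3) openE by blast
    obtain t where t: "0 < t" "t \<le> 1" "t * norm (z0 - z) < e"
      using ex_small_step[OF e(1)] .
    define x where "x = z + t *\<^sub>R (z0 - z)"
    have "x \<in> M p"
      unfolding x_def by (rule convex_segment_step[OF conv[OF p] z(1) z0(1) t(1,2)])
    moreover have "x \<in> V"
      using e(2) t by (auto simp: x_def dist_norm)
    moreover have "norm x < R"
    proof -
      have "x = (1 - t) *\<^sub>R z + t *\<^sub>R z0" by (simp add: x_def algebra_simps)
      then have "norm x \<le> (1 - t) * norm z + t * norm z0"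
        using t norm_triangle_ineq[of "(1 - t) *\<^sub>R z" "t *\<^sub>R z0"] by simp
      also have "\<dots> < (1 - t) * R + t * R"
        using t z z0 by (intro add_le_less_mono mult_left_mono mult_strict_left_mono) auto
      finally show ?thesis by (simp add: algebra_simps)
    qed
    ultimately show ?thesis by auto
  qed
  then have "{p \<in> P. M p \<inter> cball 0 R \<inter> V \<noteq> {}} = {p \<in> P. M p \<inter> (ball 0 R \<inter> V) \<noteq> {}}"
    by force
  then show "openin (top_of_set P) {p \<in> P. M p \<inter> cball 0 R \<inter> V \<noteq> {}}"
    using lsc V unfolding lower_semicontinuous_map_def by (simp add: open_Int)
qed

text \<open>A relative ball in \<open>K\<close>, shrunk far enough towards \<open>y\<close>, has its
  centre in the open ball of radius \<open>R\<close>.\<close>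

lemma relative_interior_Int_cball:
  fixes S :: "'a::real_normed_vector set"
  assumes S: "subspace S" and K: "convex K" "K \<subseteq> S"
    and z0: "z0 \<in> K" "e0 > 0" "ball z0 e0 \<inter> S \<subseteq> K" and y: "y \<in> K" "norm y < R"
  shows "\<exists>z\<in>K \<inter> cball 0 R. \<exists>e>0. ball z e \<inter> S \<subseteq> K \<inter> cball 0 R"
proof -
  obtain t where t: "0 < t" "t \<le> 1" "t * norm (z0 - y) < R - norm y"
    using ex_small_step y(2) by (metis diff_gt_0_iff_gt)
  define z where "z = y + t *\<^sub>R (z0 - y)"
  have z: "z \<in> K" unfolding z_def by (rule convex_segment_step[OF K(1) y(1) z0(1) t(1,2)])
  have "norm z \<le> norm y + t * norm (z0 - y)"
    using norm_triangle_ineq[of y "t *\<^sub>R (z0 - y)"] t by (simp add: z_def)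
  then have norm_z: "norm z < R" using t by simp
  have "ball z (t * e0) \<inter> S \<subseteq> K"
    unfolding z_def by (rule relative_ball_shrink[OF S K y(1) z0(3) t(1,2)])
  moreover have "ball z (R - norm z) \<subseteq> cball 0 R"
    by (auto simp: dist_norm) (smt (verit) norm_triangle_sub norm_minus_commute)
  ultimately have "ball z (min (t * e0) (R - norm z)) \<inter> S \<subseteq> K \<inter> cball 0 R"
    by auto
  moreover have "min (t * e0) (R - norm z) > 0" using t z0 norm_z by simp
  ultimately show ?thesis using z norm_z by (metis IntI mem_cball_0 less_imp_le)
qed

text \<open>\<open>y\<close> minimizes \<open>y'\<close> over the truncated set, and so does some
  \<open>x\<close> in the open ball: \<open>y\<close> itself or, on the sphere, the point from
  \<open>boundary\<close>. A local minimizer of a linear functional over a convex set is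
  global.\<close>

lemma nonneg_on_convex_if_nonneg_on_Int_cball:
  fixes y :: "'a::real_inner"
  assumes K: "convex K" "y \<in> K" "norm y \<le> R"
    and nonneg: "\<And>x. x \<in> K \<Longrightarrow> norm x \<le> R \<Longrightarrow> y' \<bullet> (x - y) \<ge> 0"
    and boundary: "norm y = R \<Longrightarrow> \<exists>x\<in>K. norm x < R \<and> y' \<bullet> (x - y) \<le> 0"
    and z: "z \<in> K"
  shows "y' \<bullet> (z - y) \<ge> 0"
proof -
  obtain x where x: "x \<in> K" "norm x < R" "y' \<bullet> (x - y) \<le> 0"
    using boundary K by (cases "norm y = R") auto
  have "y' \<bullet> (z - x) \<ge> 0"
  proof (rule nonneg_on_convex_if_nonneg_near[OF K(1) x(1) _ z])
    show "R - norm x > 0" using x(2) by simp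
    fix u assume u: "u \<in> K" "dist u x < R - norm x"
    then have "norm u \<le> R"
      using norm_triangle_sub[of u x] by (simp add: dist_norm)
    from nonneg[OF u(1) this] show "y' \<bullet> (u - x) \<ge> 0"
      using x(3) by (simp add: inner_diff_right)
  qed
  moreover have "y' \<bullet> (x - y) \<ge> 0" using x by (intro nonneg) auto
  ultimately show ?thesis by (simp add: inner_diff_right)
qed

section \<open>Block decomposition\<close>

lemma subspace_block_space: "subspace (block_space blk i)"
  by (auto simp: subspace_def block_space_def)

lemma linear_block: "linear (block blk i)"
  by (auto intro!: linearI simp: block_def vec_eq_iff)

lemma block_in_block_space: "block blk i x \<in> block_space blk i"
  by (simp add: block_def block_space_def)

lemma block_of_block_space:
  assumes "x \<in> block_space blk k"
  shows "block blk i x = (if i = k then x else 0)"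
  using assms by (auto simp: block_def block_space_def vec_eq_iff)

lemma block_sum:
  assumes "finite I" "i \<in> I" "\<And>k. k \<in> I \<Longrightarrow> x k \<in> block_space blk k"
  shows "block blk i (\<Sum>k\<in>I. x k) = x i"
proof -
  have "block blk i (\<Sum>k\<in>I. x k) = (\<Sum>k\<in>I. if i = k then x k else 0)"
    unfolding linear_sum[OF linear_block]
    by (intro sum.cong) (auto simp: block_of_block_space assms(3))
  then show ?thesis using assms by simp
qed

lemma sum_block:
  assumes "finite I" "range blk \<subseteq> I"
  shows "(\<Sum>i\<in>I. block blk i x) = x"
  using assms by (auto simp: vec_eq_iff block_def)

lemma inner_block: "x \<bullet> block blk i y = block blk i x \<bullet> block blk i y"
  by (auto simp: block_def inner_vec_def intro!: sum.cong)

section \<open>The coupled variational inequality\<close>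

theorem theorem3p3:
  fixes N :: nat and d :: "nat \<Rightarrow> nat" and blk :: "'n::finite \<Rightarrow> nat"
    and g :: "real ^ 'n \<Rightarrow> real ^ 'm::finite" and P :: "(real ^ 'm) set"
    and M :: "nat \<Rightarrow> real ^ 'm \<Rightarrow> (real ^ 'n) set"
    and G :: "nat \<Rightarrow> real ^ 'n \<Rightarrow> (real ^ 'n) set"
    and r :: "nat \<Rightarrow> real ^ 'm \<Rightarrow> real"
  assumes "\<And>i. i \<in> {1..N} \<Longrightarrow> d i > 0"
    and "(\<Sum>i\<in>{1..N}. d i) = CARD('n)"
    and "\<And>i. i \<in> {1..N} \<Longrightarrow> card {j. blk j = i} = d i"
    and "affine_map g"
    and "P \<noteq> {}" and "convex P" and "compact P"
    and "\<And>i p. i \<in> {1..N} \<Longrightarrow> p \<in> P \<Longrightarrow> M i p \<subseteq> block_space blk i"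
    and "\<And>i p. i \<in> {1..N} \<Longrightarrow> p \<in> P \<Longrightarrow> convex (M i p)"
    and "\<And>i. i \<in> {1..N} \<Longrightarrow> lower_semicontinuous_map P (M i)"
    and "\<And>i. i \<in> {1..N} \<Longrightarrow> closed (map_graph P (M i))"
    and "\<And>i p. i \<in> {1..N} \<Longrightarrow> p \<in> P \<Longrightarrow>
           top_of_set (block_space blk i) interior_of M i p \<noteq> {}"
    and "\<And>i x. i \<in> {1..N} \<Longrightarrow> x \<in> block_space blk i \<Longrightarrow> G i x \<subseteq> block_space blk i"
    and "\<And>i. i \<in> {1..N} \<Longrightarrow>
           locally_upper_sign_continuous_over (block_space blk i) (convex hull (\<Union>p\<in>P. M i p)) (G i)"
    and "\<And>i. i \<in> {1..N} \<Longrightarrow>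
           dually_lower_semicontinuous_over (convex hull (\<Union>p\<in>P. M i p)) (G i)"
    and "\<And>i. i \<in> {1..N} \<Longrightarrow> quasimonotone_over (convex hull (\<Union>p\<in>P. M i p)) (G i)"
    and "\<And>i p. i \<in> {1..N} \<Longrightarrow> p \<in> P \<Longrightarrow> r i p > 0"
    and "\<And>i p y. i \<in> {1..N} \<Longrightarrow> p \<in> P \<Longrightarrow> y \<in> M i p - cball 0 (r i p) \<Longrightarrow>
           \<exists>z\<in>M i p. norm z < norm y \<and> (\<forall>y'\<in>G i y. y' \<bullet> (z - y) \<le> 0)"
    and "\<And>i. i \<in> {1..N} \<Longrightarrow>
           \<exists>R::real. ereal R > (SUP p\<in>P. ereal (r i p)) \<and> (\<forall>p\<in>P. M i p \<inter> cball 0 R \<noteq> {})"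
  shows "\<exists>p0\<in>P. \<exists>y\<in>block_product blk {1..N} (\<lambda>i. M i p0). \<exists>y'.
           (\<forall>i\<in>{1..N}. block blk i y' \<in> G i (block blk i y) - {0}) \<and>
           (\<forall>p\<in>P. \<forall>z\<in>block_product blk {1..N} (\<lambda>i. M i p0).
              g y \<bullet> (p - p0) + y' \<bullet> (z - y) \<ge> 0)"
proof -

  \<comment> \<open>Index set and truncation radii\<close>
  define I where "I = {1..N}"
  have fin_I: "finite I" by (simp add: I_def)
  note M_S = assms(8)[folded I_def] and M_conv = assms(9)[folded I_def]
    and M_lsc = assms(10)[folded I_def] and M_graph = assms(11)[folded I_def]
    and M_int = assms(12)[folded I_def] and G_S = assms(13)[folded I_def]
    and G_lusc = assms(14)[folded I_def] and G_dlsc = assms(15)[folded I_def]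
    and G_qm = assms(16)[folded I_def] and r_pos = assms(17)[folded I_def]
    and coercive = assms(18)[folded I_def]
  \<comment> \<open>The block sizes add up to the dimension, so no coordinate carries a label
    outside \<open>I\<close>.\<close>
  have "card (\<Union>i\<in>I. {j. blk j = i}) = (\<Sum>i\<in>I. card {j. blk j = i})"
    by (rule card_UN_disjoint) (auto simp: fin_I)
  also have "\<dots> = CARD('n)"
    using assms(2,3) by (simp add: I_def)
  finally have "(\<Union>i\<in>I. {j. blk j = i}) = UNIV"
    by (intro card_eq_UNIV_imp_eq_UNIV) auto
  then have blk_I: "range blk \<subseteq> I" by blast
  note sum_block_I = sum_block[OF fin_I blk_I]

  have "\<exists>R. \<forall>i\<in>I. (SUP p\<in>P. ereal (r i p)) < ereal (R i) \<and> (\<forall>p\<in>P. M i p \<inter> cball 0 (R i) \<noteq> {})"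
    using assms(19) unfolding I_def by (intro bchoice) auto
  then obtain R where R_sup: "\<And>i. i \<in> I \<Longrightarrow> (SUP p\<in>P. ereal (r i p)) < ereal (R i)"
    and R_ne: "\<And>i p. i \<in> I \<Longrightarrow> p \<in> P \<Longrightarrow> M i p \<inter> cball 0 (R i) \<noteq> {}"
    by blast
  have r_R: "r i p < R i" if "i \<in> I" "p \<in> P" for i p
    using SUP_upper[of p P "\<lambda>p. ereal (r i p)"] R_sup[OF that(1)] that(2)
    by (metis ereal_less_eq(3) le_less_trans less_ereal.simps(1))
  have slater: "\<exists>z\<in>M i p. norm z < R i" if ip: "i \<in> I" "p \<in> P" for i p
  proof -
    obtain y where y: "y \<in> M i p" "norm y \<le> R i" using R_ne[OF ip] by auto
    show ?thesis
    proof (cases "norm y = R i")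
      case True
      then show ?thesis using coercive[OF ip, of y] y r_R[OF ip] by auto
    next
      case False
      with y show ?thesis by (intro bexI[of _ y]) auto
    qed
  qed

  \<comment> \<open>Truncated constraint sets\<close>
  define H where "H i = convex hull (\<Union>p\<in>P. M i p)" for i
  have op: "quasimonotone_operator (block_space blk i) (H i) (G i)" if i: "i \<in> I" for i
  proof
    show "H i \<subseteq> block_space blk i"
      unfolding H_def using M_S[OF i] subspace_imp_convex[OF subspace_block_space]
      by (intro hull_minimal) blast+
  qed (use i G_S G_lusc G_dlsc G_qm subspace_block_space in \<open>auto simp: H_def\<close>)
  define K where "K i p = M i p \<inter> cball 0 (R i)" for i p
  have K_H: "K i p \<subseteq> H i" if "i \<in> I" "p \<in> P" for i p
    unfolding K_def H_def using that by (intro order_trans[OF _ hull_subset]) auto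
  have K_conv: "convex (K i p)" if "i \<in> I" "p \<in> P" for i p
    using M_conv[OF that] by (simp add: K_def convex_Int)
  have K_lsc: "lower_semicontinuous_map P (K i)" if i: "i \<in> I" for i
    unfolding K_def using M_lsc M_conv slater i
    by (intro lower_semicontinuous_map_Int_cball) auto
  have K_graph: "closed (map_graph P (K i))" if i: "i \<in> I" for i
  proof -
    have "map_graph P (K i) = map_graph P (M i) \<inter> UNIV \<times> cball 0 (R i)"
      by (auto simp: map_graph_def K_def)
    then show ?thesis using M_graph[OF i] by (simp add: closed_Int closed_Times)
  qed
  have K_int: "\<exists>z\<in>K i p. \<exists>e>0. ball z e \<inter> block_space blk i \<subseteq> K i p"
    if ip: "i \<in> I" "p \<in> P" for i p
  proof -
    obtain U z0 where "openin (top_of_set (block_space blk i)) U" "z0 \<in> U" "U \<subseteq> M i p"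
      using M_int[OF ip] by (auto simp: interior_of_def)
    then obtain e0 where "z0 \<in> M i p" "e0 > 0" "ball z0 e0 \<inter> block_space blk i \<subseteq> M i p"
      unfolding openin_contains_ball by (meson in_mono order_trans)
    moreover obtain y where "y \<in> M i p" "norm y < R i" using slater[OF ip] by blast
    ultimately show ?thesis
      unfolding K_def
      by (rule relative_interior_Int_cball[OF subspace_block_space M_conv[OF ip] M_S[OF ip]])
  qed
  have K_compact: "compact (K i p)" if ip: "i \<in> I" "p \<in> P" for i p
  proof -
    have "closed (Pair p -` map_graph P (K i))"
      by (intro continuous_closed_vimage K_graph ip continuous_intros)
    also have "Pair p -` map_graph P (K i) = K i p"
      using ip by (auto simp: map_graph_def)
    finally show ?thesis
      by (simp add: compact_eq_bounded_closed K_def bounded_Int)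
  qed

  \<comment> \<open>Minty solution maps\<close>
  define Y where "Y i p = minty (K i p) (G i)" for i p
  have Y_K: "Y i p \<subseteq> K i p" for i p by (auto simp: Y_def minty_def)
  have Y_ne: "Y i p \<noteq> {}" if "i \<in> I" "p \<in> P" for i p
    using K_int[OF that] quasimonotone_operator.minty_nonempty[OF op K_compact K_conv K_H] that
    unfolding Y_def by blast
  have Y_conv: "convex (Y i p)" if "i \<in> I" "p \<in> P" for i p
    unfolding Y_def by (intro convex_minty K_conv that)
  have Y_graph: "closed (map_graph P (Y i))" if "i \<in> I" for i
    unfolding Y_def
    by (intro quasimonotone_operator.closed_graph_minty[OF op] K_conv K_H K_lsc K_graph K_int that)

  \<comment> \<open>Fixed point of the product map\<close>
  define D where "D = {x. \<forall>i\<in>I. block blk i x \<in> cball 0 (R i)}"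
  have D: "D = (\<Inter>i\<in>I. block blk i -` cball 0 (R i))" by (auto simp: D_def)
  have cont_block: "continuous_on A (block blk i)" for A i
    by (rule linear_continuous_on) (simp add: linear_block flip: linear_conv_bounded_linear)
  have D_compact: "compact D"
  proof -
    have "norm x \<le> (\<Sum>i\<in>I. R i)" if x: "x \<in> D" for x
    proof -
      have "norm x = norm (\<Sum>i\<in>I. block blk i x)" by (simp add: sum_block_I)
      also have "\<dots> \<le> (\<Sum>i\<in>I. R i)"
        using x by (intro sum_norm_le) (simp add: D_def)
      finally show ?thesis .
    qed
    then have "bounded D" by (auto simp: bounded_iff)
    moreover have "closed D"
      unfolding D by (intro closed_INT ballI closed_vimage closed_cball cont_block)
    ultimately show ?thesis by (simp add: compact_eq_bounded_closed)
  qed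
  have D_conv: "convex D"
    unfolding D by (intro convex_INT convex_linear_vimage linear_block convex_cball)

  \<comment> \<open>The domain must be independent of \<open>p\<close>, so \<open>y\<close> ranges
    over a product of balls.\<close>
  define C where "C = P \<times> D"
  \<comment> \<open>The first factor holds the minimizers of \<open>g y\<close> over
    \<open>P\<close>, the second the vectors whose blocks are Minty solutions for \<open>p\<close>;
    a fixed point solves the truncated coupled problem.\<close>
  define F where "F = (\<lambda>(p, y). {q\<in>P. \<forall>q'\<in>P. g y \<bullet> (q' - q) \<ge> 0} \<times> {x. \<forall>i\<in>I. block blk i x \<in> Y i p})"
  have cont_g: "continuous_on A g" for A
  proof -
    obtain L b where L: "linear L" "\<And>x. g x = L x + b" using assms(4) by (auto simp: affine_map_def)
    have "continuous_on A L"
      using L(1) by (intro linear_continuous_on) (simp add: linear_conv_bounded_linear)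
    then show ?thesis unfolding L(2) by (intro continuous_on_add continuous_on_const)
  qed
  have Y_D: "x \<in> D" if "\<forall>i\<in>I. block blk i x \<in> Y i p" for x p
    using that Y_K by (fastforce simp: D_def K_def)
  have F_C: "F c \<subseteq> C" for c
    using Y_D by (auto simp: F_def C_def split_beta)
  have F_ne: "F c \<noteq> {}" if c: "c \<in> C" for c
  proof -
    obtain p y where py: "c = (p, y)" "p \<in> P" using c by (auto simp: C_def)
    have "continuous_on P (\<lambda>q. g y \<bullet> q)" by (intro continuous_intros)
    then obtain q where q: "q \<in> P" "\<forall>q'\<in>P. g y \<bullet> q \<le> g y \<bullet> q'"
      using continuous_attains_inf[OF assms(7,5)] by blast
    have "\<forall>i\<in>I. \<exists>x. x \<in> Y i p" using Y_ne py(2) by blast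
    then obtain x where x: "\<And>i. i \<in> I \<Longrightarrow> x i \<in> Y i p" by metis
    \<comment> \<open>Membership in the factor spaces ensures that the blocks of the sum are the
      selected \<open>x i\<close>.\<close>
    have "x i \<in> block_space blk i" if "i \<in> I" for i
      using x[OF that] Y_K[of i p] M_S[OF that py(2)] unfolding K_def by blast
    then have "block blk i (\<Sum>k\<in>I. x k) = x i" if "i \<in> I" for i
      using that fin_I by (intro block_sum)
    then have "(q, \<Sum>k\<in>I. x k) \<in> F c"
      using q x py by (simp add: F_def inner_diff_right)
    then show ?thesis by blast
  qed
  have F_conv: "convex (F c)" if c: "c \<in> C" for c
  proof -
    obtain p y where py: "c = (p, y)" "p \<in> P" using c by (auto simp: C_def)
    have "{q\<in>P. \<forall>q'\<in>P. g y \<bullet> (q' - q) \<ge> 0} = P \<inter> (\<Inter>q'\<in>P. {q. g y \<bullet> q \<le> g y \<bullet> q'})"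
      by (auto simp: inner_diff_right)
    moreover have "{x. \<forall>i\<in>I. block blk i x \<in> Y i p} = (\<Inter>i\<in>I. block blk i -` Y i p)"
      by auto
    ultimately have "F c = (P \<inter> (\<Inter>q'\<in>P. {q. g y \<bullet> q \<le> g y \<bullet> q'})) \<times> (\<Inter>i\<in>I. block blk i -` Y i p)"
      by (simp add: F_def py)
    then show ?thesis
      using py(2) by (auto intro!: convex_Times convex_Int convex_INT convex_halfspace_le
          convex_linear_vimage linear_block Y_conv assms(6))
  qed
  have F_graph: "closed (map_graph C F)"
  proof -
    have "map_graph C F = (C \<times> (P \<times> UNIV))
        \<inter> (\<Inter>q'\<in>P. {z. 0 \<le> g (snd (fst z)) \<bullet> (q' - fst (snd z))})
        \<inter> (\<Inter>i\<in>I. (\<lambda>z. (fst (fst z), block blk i (snd (snd z)))) -` map_graph P (Y i))"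
      by (auto simp: map_graph_def F_def C_def)
    moreover have "closed (C \<times> (P \<times> (UNIV :: (real ^ 'n) set)))"
      unfolding C_def
      by (intro closed_Times compact_imp_closed[OF D_compact] compact_imp_closed[OF assms(7)] closed_UNIV)
    moreover have "closed {z :: ((real ^ 'm) \<times> (real ^ 'n)) \<times> ((real ^ 'm) \<times> (real ^ 'n)).
        0 \<le> g (snd (fst z)) \<bullet> (q' - fst (snd z))}" for q'
      by (intro closed_Collect_le continuous_intros continuous_on_compose2[OF cont_g]) auto
    moreover have "closed ((\<lambda>z :: ((real ^ 'm) \<times> (real ^ 'n)) \<times> ((real ^ 'm) \<times> (real ^ 'n)).
        (fst (fst z), block blk i (snd (snd z)))) -` map_graph P (Y i))" if "i \<in> I" for i
      by (intro closed_vimage Y_graph that continuous_intros continuous_on_compose2[OF cont_block]) auto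
    ultimately show ?thesis by (auto intro!: closed_Int closed_INT)
  qed
  have "0 \<in> D"
  proof -
    obtain p where p: "p \<in> P" using assms(5) by blast
    have "R i \<ge> 0" if "i \<in> I" for i
      using r_pos[OF that p] r_R[OF that p] by simp
    then show ?thesis by (simp add: D_def linear_0[OF linear_block])
  qed
  then have "\<exists>c\<in>C. c \<in> F c"
    using D_compact D_conv assms(5-7) F_ne F_conv F_C F_graph
    by (intro kakutani) (auto simp: C_def compact_Times convex_Times)
  then obtain p0 y where p0: "p0 \<in> P" "\<forall>p\<in>P. g y \<bullet> (p - p0) \<ge> 0"
    and y: "\<And>i. i \<in> I \<Longrightarrow> block blk i y \<in> Y i p0"
    by (auto simp: F_def C_def)

  \<comment> \<open>Removal of the truncation and assembly of the multiplier\<close>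
  have "\<exists>w\<in>G i (block blk i y) - {0}. \<forall>z\<in>M i p0. w \<bullet> (z - block blk i y) \<ge> 0" if i: "i \<in> I" for i
  proof -
    have "block blk i y \<in> stampacchia (K i p0) (G i)"
      using quasimonotone_operator.stampacchia_eq_minty[OF op[OF i] K_conv K_H] K_int[OF i p0(1)]
        y[OF i] i p0(1) unfolding Y_def by blast
    then obtain w where w: "block blk i y \<in> K i p0" "w \<in> G i (block blk i y) - {0}"
      "\<And>z. z \<in> K i p0 \<Longrightarrow> w \<bullet> (z - block blk i y) \<ge> 0"
      unfolding stampacchia_def by blast
    have "w \<bullet> (z - block blk i y) \<ge> 0" if z: "z \<in> M i p0" for z
    proof (rule nonneg_on_convex_if_nonneg_on_Int_cball[OF M_conv[OF i p0(1)] _ _ _ _ z])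
      \<comment> \<open>On the sphere the norm \<open>R i\<close> exceeds \<open>r i p0\<close>, so
        coercivity gives a shorter point whose inequality holds for every multiplier, in particular
        for \<open>w\<close>.\<close>
      assume "norm (block blk i y) = R i"
      then show "\<exists>x\<in>M i p0. norm x < R i \<and> w \<bullet> (x - block blk i y) \<le> 0"
        using coercive[OF i p0(1), of "block blk i y"] w r_R[OF i p0(1)] by (auto simp: K_def)
    qed (use w in \<open>auto simp: K_def\<close>)
    then show ?thesis using w(2) by blast
  qed
  then obtain w where w: "\<And>i. i \<in> I \<Longrightarrow> w i \<in> G i (block blk i y) - {0}"
    "\<And>i z. i \<in> I \<Longrightarrow> z \<in> M i p0 \<Longrightarrow> w i \<bullet> (z - block blk i y) \<ge> 0"
    by metis
  define y' where "y' = (\<Sum>i\<in>I. w i)"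
  have w_S: "w i \<in> block_space blk i" if "i \<in> I" for i
    using G_S[OF that block_in_block_space] w(1)[OF that] by blast
  have block_y': "block blk i y' = w i" if "i \<in> I" for i
    unfolding y'_def using fin_I that w_S by (intro block_sum)
  have "y' \<bullet> (z - y) \<ge> 0" if z: "z \<in> block_product blk I (\<lambda>i. M i p0)" for z
  proof -
    \<comment> \<open>Orthogonality of the factors splits the inequality into one for each
      block.\<close>
    have "y' \<bullet> (z - y) = (\<Sum>i\<in>I. y' \<bullet> block blk i (z - y))"
      by (simp add: sum_block_I flip: inner_sum_right)
    also have "\<dots> = (\<Sum>i\<in>I. w i \<bullet> (block blk i z - block blk i y))"
      by (intro sum.cong refl, subst inner_block) (simp add: block_y' linear_diff[OF linear_block])
    also have "\<dots> \<ge> 0"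
      using z by (intro sum_nonneg w(2)) (auto simp: block_product_def)
    finally show ?thesis .
  qed
  moreover have "y \<in> block_product blk I (\<lambda>i. M i p0)"
    using y Y_K by (auto simp: block_product_def K_def)
  ultimately show ?thesis
    using p0 w(1) block_y' unfolding I_def
    by (intro bexI[of _ p0] bexI[of _ y] exI[of _ y']) (auto intro: add_nonneg_nonneg)
qed

end
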